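(* Let $(A,\circ)$ be a Novikov algebra over $\mathbf{k}$ with $\dim(A)\geq 2$. If every $\frac12$-derivation of $(A,\circ)$ is trivial, then every transposed Novikov-Poisson algebra structure on $(A,\circ)$ is trivial.
   Context: $\mathbf{k}$ is a field of characteristic not equal to $2$; all binary operations are $\mathbf{k}$-bilinear and algebras need not be unital. A (left) Novikov algebra $(A,\circ)$ is a vector space with a binary operation satisfying $(x\circ y)\circ z=(x\circ z)\circ y$ and $(x\circ y)\circ z-x\circ(y\circ z)=(y\circ x)\circ z-y\circ(x\circ z)$ for all $x,y,z$. A $\frac12$-derivation of $(A,\circ)$ is a linear map $\varphi:A\to A$ with $\varphi(x\circ y)=\frac12(\varphi(x)\circ y+x\circ\varphi(y))$ for all $x,y\in A$; it is trivial if $\varphi=\alpha\,\mathrm{id}_A$ for some $\alpha\in\mathbf{k}$. A transposed Novikov-Poisson algebra is a triple $(A,\cdot,\circ)$ where $(A,\cdot)$ is a commutative associative algebra, $(A,\circ)$ is a Novikov algebra, and for all $x,y,z\in A$: $(x\cdot y)\circ z=(x\cdot z)\circ y$ and $2z\cdot(x\circ y)=(z\cdot x)\circ y+x\circ(z\cdot y)$. It is called trivial if $\cdot$ is zero or $\circ$ is zero. A transposed Novikov-Poisson algebra structure on $(A,\circ)$ is an operation $\cdot$ on $A$ making $(A,\cdot,\circ)$ a transposed Novikov-Poisson algebra, and it is called trivial if $(A,\cdot,\circ)$ is trivial. *)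

theory Defs
  imports Complex_Main
begin

text \<open>An algebra is an additive group type carrying a scalar multiplication \<^term>\<open>s\<close> that
  makes it a vector space, together with a bilinear operation (not assumed unital).\<close>

definition bilinear_op :: "('k::field \<Rightarrow> 'a::ab_group_add \<Rightarrow> 'a) \<Rightarrow> ('a \<Rightarrow> 'a \<Rightarrow> 'a) \<Rightarrow> bool" where
  "bilinear_op s m \<longleftrightarrow>
     (\<forall>x. Vector_Spaces.linear s s (\<lambda>y. m x y)) \<and> (\<forall>y. Vector_Spaces.linear s s (\<lambda>x. m x y))"

locale comm_assoc_algebra = vector_space s
  for s :: "'k::field \<Rightarrow> 'a::ab_group_add \<Rightarrow> 'a" +
  fixes dot :: "'a \<Rightarrow> 'a \<Rightarrow> 'a"
  assumes dot_bilinear: "bilinear_op s dot"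
    and dot_commute: "dot x y = dot y x"
    and dot_assoc: "dot (dot x y) z = dot x (dot y z)"

locale novikov_algebra = vector_space s
  for s :: "'k::field \<Rightarrow> 'a::ab_group_add \<Rightarrow> 'a" +
  fixes circ :: "'a \<Rightarrow> 'a \<Rightarrow> 'a"
  assumes circ_bilinear: "bilinear_op s circ"
    and circ_right_commute: "circ (circ x y) z = circ (circ x z) y"
    and circ_left_symmetric:
      "circ (circ x y) z - circ x (circ y z) = circ (circ y x) z - circ y (circ x z)"

locale transposed_novikov_poisson_algebra =
  comm_assoc_algebra s dot + novikov_algebra s circ
  for s :: "'k::field \<Rightarrow> 'a::ab_group_add \<Rightarrow> 'a"
    and dot :: "'a \<Rightarrow> 'a \<Rightarrow> 'a"
    and circ :: "'a \<Rightarrow> 'a \<Rightarrow> 'a" +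
  assumes dot_circ_commute: "circ (dot x y) z = circ (dot x z) y"
    and transposed_leibniz: "s 2 (dot z (circ x y)) = circ (dot z x) y + circ x (dot z y)"

definition trivial_tnp :: "('a::ab_group_add \<Rightarrow> 'a \<Rightarrow> 'a) \<Rightarrow> ('a \<Rightarrow> 'a \<Rightarrow> 'a) \<Rightarrow> bool" where
  "trivial_tnp dot circ \<longleftrightarrow> (\<forall>x y. dot x y = 0) \<or> (\<forall>x y. circ x y = 0)"

definition half_derivation ::
  "('k::field \<Rightarrow> 'a::ab_group_add \<Rightarrow> 'a) \<Rightarrow> ('a \<Rightarrow> 'a \<Rightarrow> 'a) \<Rightarrow> ('a \<Rightarrow> 'a) \<Rightarrow> bool" where
  "half_derivation s circ \<phi> \<longleftrightarrow>
     Vector_Spaces.linear s s \<phi> \<and>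
     (\<forall>x y. \<phi> (circ x y) = s (1 / 2) (circ (\<phi> x) y + circ x (\<phi> y)))"

definition trivial_half_derivation ::
  "('k::field \<Rightarrow> 'a::ab_group_add \<Rightarrow> 'a) \<Rightarrow> ('a \<Rightarrow> 'a) \<Rightarrow> bool" where
  "trivial_half_derivation s \<phi> \<longleftrightarrow> (\<exists>\<alpha>. \<phi> = (\<lambda>x. s \<alpha> x))"

text \<open>The library's \<open>dim\<close> is 0 on infinite-dimensional spaces, so a lower bound on the dimension
  is stated through the cardinality of a basis, which may be infinite.\<close>

definition dim_at_least :: "('k::field \<Rightarrow> 'a::ab_group_add \<Rightarrow> 'a) \<Rightarrow> nat \<Rightarrow> bool" where
  "dim_at_least s n \<longleftrightarrow>
     (\<exists>B. \<not> module.dependent s B \<and> module.span s B = UNIV \<and> (infinite B \<or> n \<le> card B))"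

end

theory Submission
  imports Defs
begin

text \<open>In a transposed Novikov-Poisson algebra the transposed Leibniz rule says exactly that each
  multiplication \<open>x \<mapsto> z \<cdot> x\<close> is a \<open>\<frac12>\<close>-derivation of \<open>\<circ>\<close>. If all of
  these are scalars, then \<open>z \<cdot> x = \<alpha>(z) x\<close>, and commutativity turns this into
  \<open>\<alpha>(z) x = \<alpha>(x) z\<close>. In dimension at least \<open>2\<close> there is, for every \<open>z\<close>, some
  \<open>x\<close> off the line through \<open>z\<close>, and comparing the two sides forces
  \<open>\<alpha>(z) = 0\<close>. Hence \<open>\<cdot>\<close> vanishes.\<close>

lemma two_neq_zero_if_CHAR_neq_2:
  assumes "CHAR('k::field) \<noteq> 2"
  shows "(2::'k) \<noteq> 0"
proof
  assume "(2::'k) = 0"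
  then have "of_nat 2 = (0::'k)" by simp
  then have "CHAR('k) dvd 2" by (simp only: of_nat_eq_0_iff_char_dvd)
  moreover have "k = 1 \<or> k = 2" if "k dvd 2" for k :: nat
    using that dvd_imp_le[OF that] by (cases "k = 0") auto
  ultimately have "CHAR('k) = 1"
    using assms by blast
  then show False by simp
qed

lemma ex_vector_off_line:
  assumes "vector_space s" and "dim_at_least s 2"
  shows "\<exists>x. x \<notin> module.span s {z}"
proof (rule ccontr)
  interpret vector_space s by fact
  assume "\<not> ?thesis"
  moreover obtain B where "independent B" "infinite B \<or> 2 \<le> card B"
    using assms(2) unfolding dim_at_least_def by blast
  ultimately show False
    using independent_span_bound[of "{z}" B] by force
qed

text \<open>Recovering the factor \<open>1 / 2\<close> in the definition of a \<open>\<frac12>\<close>-derivation from the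
  factor \<open>2\<close> in the transposed Leibniz rule is where the characteristic enters.\<close>

lemma half_derivation_dot:
  fixes s :: "'k::field \<Rightarrow> 'a::ab_group_add \<Rightarrow> 'a"
  assumes "(2::'k) \<noteq> 0" and "transposed_novikov_poisson_algebra s dot circ"
  shows "half_derivation s circ (dot z)"
proof -
  interpret transposed_novikov_poisson_algebra s dot circ by fact
  have "Vector_Spaces.linear s s (dot z)"
    using dot_bilinear unfolding bilinear_op_def by blast
  moreover have "dot z (circ x y) = s (1 / 2) (circ (dot z x) y + circ x (dot z y))" for x y
    unfolding transposed_leibniz[symmetric] using assms(1) by simp
  ultimately show ?thesis
    unfolding half_derivation_def by blast
qed

text \<open>On a line every product has scalar multiplication operators, so the dimension bound is
  essential: it supplies an \<open>x\<close> for which \<open>\<alpha>(z) x = \<alpha>(x) z\<close> is a relation between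
  a vector outside the span of \<open>z\<close> and that span.\<close>

lemma commutative_scalar_product_eq_zero:
  assumes "vector_space s" and "dim_at_least s 2"
    and commute: "\<And>x y. dot x y = dot y x"
    and scalar: "\<And>z x. dot z x = s (\<alpha> z) x"
  shows "dot z y = 0"
proof -
  interpret vector_space s by fact
  obtain x where x: "x \<notin> span {z}"
    using ex_vector_off_line[OF assms(1,2)] by blast
  have eq: "s (\<alpha> z) x = s (\<alpha> x) z"
    using commute[of z x] by (simp add: scalar)
  have "\<alpha> z = 0"
  proof (rule ccontr)
    assume "\<alpha> z \<noteq> 0"
    then have "x = s (inverse (\<alpha> z)) (s (\<alpha> z) x)" by simp
    also have "\<dots> \<in> span {z}"
      unfolding eq by (intro span_scale span_base) simp
    finally show False using x by contradiction
  qed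
  then show ?thesis by (simp add: scalar)
qed

theorem theorem3p5:
  fixes s :: "'k::field \<Rightarrow> 'a::ab_group_add \<Rightarrow> 'a"
    and circ :: "'a \<Rightarrow> 'a \<Rightarrow> 'a"
  assumes "CHAR('k) \<noteq> 2"
    and "novikov_algebra s circ"
    and "dim_at_least s 2"
    and "\<forall>\<phi>. half_derivation s circ \<phi> \<longrightarrow> trivial_half_derivation s \<phi>"
  shows "\<forall>dot. transposed_novikov_poisson_algebra s dot circ \<longrightarrow> trivial_tnp dot circ"
proof (intro allI impI)
  fix dot
  assume tnp: "transposed_novikov_poisson_algebra s dot circ"
  interpret transposed_novikov_poisson_algebra s dot circ by fact
  have "trivial_half_derivation s (dot z)" for z
    using half_derivation_dot[OF two_neq_zero_if_CHAR_neq_2[OF assms(1)] tnp] assms(4) by blast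
  then obtain \<alpha> where "\<And>z x. dot z x = s (\<alpha> z) x"
    unfolding trivial_half_derivation_def fun_eq_iff by metis
  then have "dot x y = 0" for x y
    using commutative_scalar_product_eq_zero[where dot = dot, OF vector_space_axioms assms(3)]
      dot_commute by blast
  then show "trivial_tnp dot circ"
    unfolding trivial_tnp_def by blast
qed

end
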